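(* Let $\beta$ be a Pisot number. Let $[0,1]=\bigcup_{i=1}^{\ell} J_i$ be a finite partition of $[0,1]$ into subintervals, and let $S:[0,1]\to[0,1]$ be given by $$S(x)=\epsilon_i \beta^{m_i} x + b_i \quad\text{for } x\in J_i,$$ where $\epsilon_i\in\{-1,1\}$, $m_i$ is a positive integer and $b_i\in\mathbb{Q}(\beta)$ for $1\le i\le \ell$ (these data are assumed to be such that $S$ maps $[0,1]$ into $[0,1]$). Then for $x\in[0,1]$, the orbit $(S^n(x))_{n\ge 0}$ is eventually periodic if and only if $x\in\mathbb{Q}(\beta)$.
   Context: A Pisot number is a real algebraic integer greater than one all of whose Galois conjugates other than itself have modulus less than one. The subintervals $J_i$ may be closed, open, half-open, or singletons. *)

theory Defs
  imports "HOL-Analysis.Analysis" "HOL-Computational_Algebra.Polynomial"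
begin

text \<open>A Pisot number: a real algebraic integer greater than one whose Galois conjugates
  other than itself all have modulus less than one. The minimal polynomial of an algebraic
  integer is a monic irreducible integer polynomial; its complex roots are the conjugates.\<close>
definition pisot :: "real \<Rightarrow> bool" where
  "pisot \<beta> \<longleftrightarrow> \<beta> > 1 \<and>
     (\<exists>p :: int poly. lead_coeff p = 1 \<and> irreducible p \<and>
        poly (map_poly of_int p) \<beta> = 0 \<and>
        (\<forall>z :: complex. poly (map_poly of_int p) z = 0 \<and> z \<noteq> complex_of_real \<beta> \<longrightarrow> cmod z < 1))"

definition rat_adjoin :: "real \<Rightarrow> real set" where
  "rat_adjoin \<beta> = {x. \<exists>p q :: rat poly. poly (map_poly of_rat q) \<beta> \<noteq> 0 \<and>
       x = poly (map_poly of_rat p) \<beta> / poly (map_poly of_rat q) \<beta>}"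

definition eventually_periodic :: "('a \<Rightarrow> 'a) \<Rightarrow> 'a \<Rightarrow> bool" where
  "eventually_periodic S x \<longleftrightarrow>
     (\<exists>N p. p > 0 \<and> (\<forall>n\<ge>N. (S ^^ (n + p)) x = (S ^^ n) x))"

end

theory Submission
  imports Defs "HOL-Computational_Algebra.Polynomial_Factorial"
    "HOL-Computational_Algebra.Fundamental_Theorem_Algebra"
begin

text \<open>
  Iterating gives \<open>S\<^sup>n(x) = A x + B\<close> with \<open>A = \<plusminus>\<beta>\<^sup>M\<close>, \<open>M \<ge> n\<close> and \<open>B \<in> \<rat>(\<beta>)\<close>, so
  an eventually periodic point solves a nondegenerate linear equation over \<open>\<rat>(\<beta>)\<close>.
  Conversely, for \<open>x \<in> \<rat>(\<beta>)\<close> a common denominator \<open>c\<close> of \<open>x\<close> and the \<open>b\<^sub>i\<close> puts the whole orbit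
  in \<open>(1/c) \<int>[\<beta>]\<close>. The orbit is bounded because it lies in \<open>[0,1]\<close>, and its conjugates are bounded
  because conjugating turns \<open>S\<close> into contractions of ratio at most \<open>|z| < 1\<close>; an algebraic integer
  of \<open>\<int>[\<beta>]\<close> with all conjugates bounded lies in a finite set. All facts on the minimal polynomial
  \<open>p\<close> (simple roots, inverses in \<open>\<rat>(\<beta>)\<close>) come from one Bezout identity
  \<open>u p + v f = c \<noteq> 0\<close> in \<open>\<int>[X]\<close>, valid whenever \<open>p\<close> does not divide \<open>f\<close>.
\<close>

section \<open>Integer polynomials: evaluation, a Bezout identity and simple roots\<close>

abbreviation int_eval :: "int poly \<Rightarrow> 'a::comm_ring_1 \<Rightarrow> 'a" where
  "int_eval p \<equiv> poly (map_poly of_int p)"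

lemma int_eval_pCons [simp]: "int_eval (pCons a p) x = of_int a + x * int_eval p x"
  by (simp add: map_poly_pCons)

lemma int_eval_add [simp]: "int_eval (p + q) x = int_eval p x + int_eval q x"
proof -
  have "map_poly of_int (p + q) = map_poly of_int p + (map_poly of_int q :: 'a poly)"
    by (rule poly_eqI) (simp add: coeff_map_poly)
  then show ?thesis by simp
qed

lemma int_eval_smult [simp]: "int_eval (smult a p) x = of_int a * int_eval p x"
  by (induction p) (simp_all add: algebra_simps)

lemma int_eval_mult [simp]: "int_eval (p * q) x = int_eval p x * int_eval q x"
  by (induction p) (simp_all add: algebra_simps)

lemma int_eval_monom [simp]: "int_eval (monom a n) x = of_int a * x ^ n"
  by (simp add: map_poly_monom poly_monom)

text \<open>Conjugates of a number are obtained by evaluating an integer polynomial that represents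
  it at the other roots. This ties evaluation at the real \<beta> to evaluation at the same point of
  the complex plane.\<close>

lemma int_eval_of_real: "int_eval p (of_real x :: complex) = of_real (int_eval p x)"
  by (induction p) simp_all

lemma pderiv_map_poly_of_int:
  "pderiv (map_poly of_int p) =
    (map_poly of_int (pderiv p) :: 'a::{comm_ring_1, semiring_no_zero_divisors} poly)"
  by (rule poly_eqI) (simp add: coeff_map_poly coeff_pderiv)

text \<open>Z[X] is not a principal ideal domain, so \<open>g\<close> is only an element of least
  degree in the ideal \<open>(p, f)\<close>. By pseudo-division it divides a nonzero integer
  multiple of every ideal element. For \<open>f\<close> this excludes \<open>p dvd g\<close>; for
  \<open>p\<close> it then forces \<open>g\<close> to be constant.\<close>

lemma irreducible_int_poly_bezout:
  fixes p f :: "int poly"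
  assumes "irreducible p" "degree p > 0" "\<not> p dvd f"
  obtains u v c where "c \<noteq> 0" "u * p + v * f = [:c:]"
proof -
  have prime: "prime_elem p"
    using assms(1) by (rule irreducible_imp_prime_elem)
  define I where "I = {g. \<exists>u v. g = u * p + v * f}"
  have smult_I: "smult c h \<in> I" if "h \<in> I" for c h
  proof -
    from that obtain u v where "h = u * p + v * f" by (auto simp: I_def)
    then have "smult c h = smult c u * p + smult c v * f" by (simp add: smult_add_right)
    then show ?thesis unfolding I_def by blast
  qed
  have diff_I: "h - g * q \<in> I" if h: "h \<in> I" and g: "g \<in> I" for h g q
  proof -
    from h obtain u v where "h = u * p + v * f" by (auto simp: I_def)
    moreover from g obtain u' v' where "g = u' * p + v' * f" by (auto simp: I_def)
    ultimately have "h - g * q = (u - u' * q) * p + (v - v' * q) * f" by (simp add: algebra_simps)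
    then show ?thesis unfolding I_def by blast
  qed
  have "p = 1 * p + 0 * f" "f = 0 * p + 1 * f" by simp_all
  then have pI: "p \<in> I" and fI: "f \<in> I" unfolding I_def by blast+
  have p0: "p \<noteq> 0" using assms(2) by auto
  obtain g where g: "g \<in> I" "g \<noteq> 0"
    and min: "\<And>h. h \<in> I \<Longrightarrow> h \<noteq> 0 \<Longrightarrow> degree g \<le> degree h"
    using ex_has_least_nat[of "\<lambda>g. g \<in> I \<and> g \<noteq> 0" p degree] pI p0 by auto
  have pseudo_dvd: "\<exists>c. c \<noteq> 0 \<and> g dvd smult c h" if "h \<in> I" for h
  proof -
    obtain q r where qr: "pseudo_divmod h g = (q, r)" by fastforce
    define c where "c = coeff g (degree g) ^ (Suc (degree h) - degree g)"
    have c: "c \<noteq> 0" using g(2) by (simp add: c_def)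
    have eq: "smult c h = g * q + r" and r: "r = 0 \<or> degree r < degree g"
      using pseudo_divmod[OF g(2) qr] by (simp_all add: c_def)
    have "r \<in> I"
      using diff_I[OF smult_I[OF that] g(1), of c q] by (simp add: eq)
    with min r have "r = 0" by force
    then show ?thesis using c eq by auto
  qed
  \<comment> \<open>Positive degree keeps \<open>p\<close> from dividing nonzero constants, so
    primality lets a constant factor be cancelled.\<close>
  have not_dvd_const: "\<not> p dvd [:c:]" if "c \<noteq> 0" for c
    using dvd_imp_degree_le[of p "[:c:]"] assms(2) that by auto
  have p_dvd_smult: "p dvd h" if "p dvd smult c h" "c \<noteq> 0" for c h
  proof -
    have "p dvd [:c:] * h" using that(1) by simp
    from prime_elem_dvd_multD[OF prime this] not_dvd_const[OF that(2)] show ?thesis by blast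
  qed
  have not_p_dvd_g: "\<not> p dvd g"
    using pseudo_dvd[OF fI] p_dvd_smult assms(3) by (meson dvd_trans)
  from pseudo_dvd[OF pI] obtain c h where c: "c \<noteq> 0" and gh: "smult c p = g * h"
    by (auto simp: dvd_def)
  \<comment> \<open>As \<open>p\<close> divides \<open>g * h\<close> but not \<open>g\<close>, it
    divides \<open>h\<close>; cancelling \<open>p\<close> leaves \<open>g\<close> a divisor of the
    nonzero constant \<open>c\<close>.\<close>
  have "p dvd g * h" by (simp flip: gh add: dvd_smult)
  then have "p dvd h" using prime not_p_dvd_g by (auto dest: prime_elem_dvd_multD)
  then obtain k where "h = p * k" by (auto elim: dvdE)
  with gh have "p * [:c:] = p * (g * k)" by (simp add: algebra_simps)
  then have "g * k = [:c:]" using p0 by (metis mult_cancel_left)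
  then have "degree g = 0"
    using c by (metis dvdI dvd_imp_degree_le degree_pCons_0 le_zero_eq pCons_eq_0_iff)
  then obtain a where "g = [:a:]" by (auto elim: degree_eq_zeroE)
  with g that show ?thesis by (auto simp: I_def)
qed

text \<open>The derivative is nonzero and of lower degree, so \<open>p\<close> cannot divide it. At
  a common root the Bezout identity would make a nonzero constant vanish.\<close>

lemma irreducible_int_poly_simple_root:
  fixes p :: "int poly" and z :: complex
  assumes "irreducible p" "degree p > 0" "int_eval p z = 0"
  shows "int_eval (pderiv p) z \<noteq> 0"
proof -
  have "pderiv p \<noteq> 0" using assms(2) by (simp add: pderiv_eq_0_iff)
  then have "\<not> p dvd pderiv p"
    using assms(2) dvd_imp_degree_le[of p "pderiv p"] by (auto simp: degree_pderiv)
  then obtain u v c where c: "c \<noteq> 0" and eq: "u * p + v * pderiv p = [:c:]"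
    by (rule irreducible_int_poly_bezout[OF assms(1,2)])
  from arg_cong[OF eq, of "\<lambda>h. int_eval h z"] assms(3) c show ?thesis by auto
qed

section \<open>Conjugates, and finiteness of integral elements with bounded conjugates\<close>

definition int_roots :: "int poly \<Rightarrow> complex set" where
  "int_roots p = {z. int_eval p z = 0}"

text \<open>Since all roots are simple, there are exactly as many nodes as are needed to interpolate
  remainders modulo \<open>p\<close>.\<close>

lemma card_int_roots:
  assumes "irreducible p" "degree p > 0"
  shows "finite (int_roots p)" "card (int_roots p) = degree p"
proof -
  define P :: "complex poly" where "P = map_poly of_int p"
  have P0: "P \<noteq> 0" using assms(2) by (auto simp: P_def map_poly_eq_0_iff)
  have deg: "degree P = degree p" unfolding P_def by (rule map_poly_degree_eq) (use assms(2) in auto)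
  have R: "int_roots p = {z. poly P z = 0}" by (simp add: int_roots_def P_def)
  show fin: "finite (int_roots p)" unfolding R using P0 by (rule poly_roots_finite)
  have "rsquarefree P"
    using irreducible_int_poly_simple_root[OF assms]
    by (auto simp: rsquarefree_roots P_def pderiv_map_poly_of_int)
  from complex_poly_decompose_rsquarefree[OF this]
  have "degree P = degree (smult (lead_coeff P) (\<Prod>z\<in>int_roots p. [:- z, 1:]))"
    unfolding R by simp
  also have "\<dots> = card (int_roots p)"
    using P0 by (simp add: degree_prod_eq_sum_degree)
  finally show "card (int_roots p) = degree p" using deg by simp
qed

text \<open>By Lagrange interpolation the coefficients are fixed linear combinations of the values.\<close>
lemma coeff_bounded_by_values:
  fixes Z :: "complex set" and M :: "complex \<Rightarrow> real"
  assumes "finite Z"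
  obtains N where "\<And>P k. degree P < card Z \<Longrightarrow> (\<And>z. z \<in> Z \<Longrightarrow> cmod (poly P z) \<le> M z)
                      \<Longrightarrow> cmod (coeff P k) \<le> N"
proof -
  define L where "L z = smult (inverse (\<Prod>w\<in>Z - {z}. z - w)) (\<Prod>w\<in>Z - {z}. [:- w, 1:])" for z
  have L_eq: "poly (L z) w = (if w = z then 1 else 0)" if "z \<in> Z" "w \<in> Z" for z w
    using assms that by (auto simp: L_def poly_prod)
  have deg_L: "degree (L z) < card Z" if "z \<in> Z" for z
  proof -
    have "degree (L z) \<le> (\<Sum>w\<in>Z - {z}. degree [:- w, 1:])"
      unfolding L_def using degree_prod_sum_le[of "Z - {z}" "\<lambda>w. [:- w, 1:]"] assms
      by (intro order_trans[OF degree_smult_le]) (simp add: o_def)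
    also have "\<dots> < card Z"
      using card_Diff1_less[OF assms that] by simp
    finally show ?thesis .
  qed
  define C where "C z = (\<Sum>k<card Z. cmod (coeff (L z) k))" for z
  have C: "cmod (coeff (L z) k) \<le> C z" if "z \<in> Z" for z k
  proof (cases "k < card Z")
    case True
    then show ?thesis unfolding C_def by (intro member_le_sum) auto
  next
    case False
    then have "coeff (L z) k = 0" using deg_L[OF that] by (intro coeff_eq_0) simp
    then show ?thesis by (simp add: C_def sum_nonneg)
  qed
  show thesis
  proof (rule that)
    fix P k
    assume deg: "degree P < card Z" and M: "\<And>z. z \<in> Z \<Longrightarrow> cmod (poly P z) \<le> M z"
    have "P = (\<Sum>z\<in>Z. smult (poly P z) (L z))"
    proof (rule poly_eqI_degree)
      show "poly P w = poly (\<Sum>z\<in>Z. smult (poly P z) (L z)) w" if "w \<in> Z" for w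
        using that assms by (simp add: poly_sum L_eq if_distrib[of "\<lambda>t. _ * t"] cong: if_cong)
      show "degree P < card Z" by fact
      show "degree (\<Sum>z\<in>Z. smult (poly P z) (L z)) < card Z"
        using deg deg_L by (intro degree_sum_less) (auto intro: le_less_trans[OF degree_smult_le])
    qed
    then have "coeff P k = (\<Sum>z\<in>Z. poly P z * coeff (L z) k)"
      by (metis (no_types, lifting) coeff_smult coeff_sum sum.cong)
    \<comment> \<open>On \<open>Z\<close> the bound \<open>M\<close> dominates a norm and is
      therefore nonnegative, so the bounds may be multiplied. The resulting sum depends on neither
      \<open>P\<close> nor \<open>k\<close>.\<close>
    also have "cmod \<dots> \<le> (\<Sum>z\<in>Z. M z * C z)"
      using M C by (intro order_trans[OF norm_sum] sum_mono)
        (auto simp: norm_mult intro!: mult_mono order_trans[OF norm_ge_zero])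
    finally show "cmod (coeff P k) \<le> (\<Sum>z\<in>Z. M z * C z)" .
  qed
qed

lemma finite_int_polys_bounded:
  "finite {p :: int poly. degree p < d \<and> (\<forall>k. \<bar>coeff p k\<bar> \<le> N)}"
proof -
  have "{p :: int poly. degree p < d \<and> (\<forall>k. \<bar>coeff p k\<bar> \<le> N)}
          \<subseteq> Poly ` {xs. set xs \<subseteq> {-N..N} \<and> length xs \<le> d}"
  proof
    fix p :: "int poly"
    assume p: "p \<in> {p. degree p < d \<and> (\<forall>k. \<bar>coeff p k\<bar> \<le> N)}"
    have "set (coeffs p) \<subseteq> range (coeff p)" using range_coeff[of p] by auto
    moreover have "range (coeff p) \<subseteq> {-N..N}" using p by (auto simp: abs_le_iff minus_le_iff)
    ultimately have "set (coeffs p) \<subseteq> {-N..N}" by blast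
    moreover have "length (coeffs p) \<le> d" using p by (cases "p = 0") (auto simp: length_coeffs_degree)
    ultimately show "p \<in> Poly ` {xs. set xs \<subseteq> {-N..N} \<and> length xs \<le> d}"
      by (intro image_eqI[of _ _ "coeffs p"]) simp_all
  qed
  then show ?thesis
    by (rule finite_subset) (intro finite_imageI finite_lists_length_le finite_atLeastAtMost_int)
qed

text \<open>The degree of \<open>R\<close> is unbounded, so \<open>R\<close> is first reduced modulo
  \<open>p\<close>. The remainder has the same values at all roots, interpolation bounds its
  coefficients, and these are integers.\<close>

lemma finite_bounded_conjugates:
  fixes p :: "int poly" and M :: "complex \<Rightarrow> real"
  assumes p: "irreducible p" "degree p > 0" "lead_coeff p = 1" and x: "x \<in> int_roots p"
  shows "finite {int_eval R x | R. \<forall>z\<in>int_roots p. cmod (int_eval R z) \<le> M z}"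
proof -
  note roots = card_int_roots[OF p(1,2)]
  obtain N where N: "\<And>P k. degree P < card (int_roots p) \<Longrightarrow>
      (\<And>z. z \<in> int_roots p \<Longrightarrow> cmod (poly P z) \<le> M z) \<Longrightarrow> cmod (coeff P k) \<le> N"
    using coeff_bounded_by_values[OF roots(1)] by blast
  have "{int_eval R x | R. \<forall>z\<in>int_roots p. cmod (int_eval R z) \<le> M z}
      \<subseteq> (\<lambda>r. int_eval r x) ` {r. degree r < degree p \<and> (\<forall>k. \<bar>coeff r k\<bar> \<le> \<lfloor>N\<rfloor>)}"
  proof clarify
    fix R assume R: "\<forall>z\<in>int_roots p. cmod (int_eval R z) \<le> M z"
    \<comment> \<open>As \<open>p\<close> is monic, the scaling factor of pseudo-division is 1 and
      this is true division over the integers.\<close>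
    obtain q r where "pseudo_divmod R p = (q, r)" by fastforce
    moreover have "p \<noteq> 0" using p(2) by auto
    ultimately have Rr: "R = p * q + r" and deg: "degree r < degree p"
      using pseudo_divmod[of p R q r] p(2,3) by auto
    have eval: "int_eval R z = int_eval r z" if "z \<in> int_roots p" for z
      using that by (simp add: Rr int_roots_def)
    have "cmod (coeff (map_poly of_int r) k) \<le> N" for k
      using R eval deg roots(2)
      by (intro N) (auto intro: le_less_trans[OF map_poly_degree_leq])
    then have "\<bar>coeff r k\<bar> \<le> \<lfloor>N\<rfloor>" for k
      by (simp add: coeff_map_poly le_floor_iff)
    with deg eval[OF x] show
      "int_eval R x \<in> (\<lambda>r. int_eval r x) ` {r. degree r < degree p \<and> (\<forall>k. \<bar>coeff r k\<bar> \<le> \<lfloor>N\<rfloor>)}"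
      by auto
  qed
  then show ?thesis by (rule finite_subset) (intro finite_imageI finite_int_polys_bounded)
qed

section \<open>The field Q(\<beta>) and common denominators\<close>

lemma rat_poly_denominator:
  fixes x :: real
  shows "\<exists>c P. c > 0 \<and> of_int c * poly (map_poly of_rat p) x = int_eval P x"
proof (induction p)
  case 0
  show ?case by (intro exI[of _ 1] exI[of _ 0]) simp
next
  case (pCons a p)
  then obtain c P where c: "c > 0" and P: "of_int c * poly (map_poly of_rat p) x = int_eval P x"
    by blast
  obtain n d where a: "a = Rat.Fract n d" and d: "d > 0" by (cases a) auto
  have "of_int (c * d) * poly (map_poly of_rat (pCons a p)) x = int_eval (pCons (n * c) (smult d P)) x"
    using d by (simp add: map_poly_pCons a of_rat_rat field_simps flip: P)
  moreover have "c * d > 0" using c d by simp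
  ultimately show ?case by blast
qed

text \<open>Clearing the denominators of both polynomials allows all later work in Q(\<beta>) to use
  integer polynomials only.\<close>

lemma rat_adjoin_iff:
  "x \<in> rat_adjoin \<beta> \<longleftrightarrow> (\<exists>P Q. int_eval Q \<beta> \<noteq> 0 \<and> x = int_eval P \<beta> / int_eval Q \<beta>)"
proof
  assume "x \<in> rat_adjoin \<beta>"
  then obtain p q where q: "poly (map_poly of_rat q) \<beta> \<noteq> 0"
    and x: "x = poly (map_poly of_rat p) \<beta> / poly (map_poly of_rat q) \<beta>"
    by (auto simp: rat_adjoin_def)
  obtain c P where c: "c > 0" "of_int c * poly (map_poly of_rat p) \<beta> = int_eval P \<beta>"
    using rat_poly_denominator by blast
  obtain d Q where d: "d > 0" "of_int d * poly (map_poly of_rat q) \<beta> = int_eval Q \<beta>"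
    using rat_poly_denominator by blast
  have "int_eval (smult c Q) \<beta> \<noteq> 0" using c d q by (auto simp flip: d(2))
  moreover have "x = int_eval (smult d P) \<beta> / int_eval (smult c Q) \<beta>"
    using c(1) d(1) q by (simp add: x flip: c(2) d(2))
  ultimately show "\<exists>P Q. int_eval Q \<beta> \<noteq> 0 \<and> x = int_eval P \<beta> / int_eval Q \<beta>" by blast
next
  have "map_poly of_rat (map_poly of_int P) = (map_poly of_int P :: real poly)" for P
    by (simp add: map_poly_map_poly o_def)
  then show "\<exists>P Q. int_eval Q \<beta> \<noteq> 0 \<and> x = int_eval P \<beta> / int_eval Q \<beta> \<Longrightarrow> x \<in> rat_adjoin \<beta>"
    unfolding rat_adjoin_def by (metis (mono_tags, lifting) mem_Collect_eq)
qed

lemma rat_adjoin_of_int: "of_int k \<in> rat_adjoin \<beta>"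
  unfolding rat_adjoin_iff by (intro exI[of _ "[:k:]"] exI[of _ "[:1:]"]) simp

lemma rat_adjoin_self: "\<beta> \<in> rat_adjoin \<beta>"
  unfolding rat_adjoin_iff by (intro exI[of _ "[:0, 1:]"] exI[of _ "[:1:]"]) simp

lemma rat_adjoin_add:
  assumes "x \<in> rat_adjoin \<beta>" "y \<in> rat_adjoin \<beta>"
  shows "x + y \<in> rat_adjoin \<beta>"
proof -
  obtain P Q P' Q' where "int_eval Q \<beta> \<noteq> 0" "x = int_eval P \<beta> / int_eval Q \<beta>"
    "int_eval Q' \<beta> \<noteq> 0" "y = int_eval P' \<beta> / int_eval Q' \<beta>"
    using assms unfolding rat_adjoin_iff by blast
  then show ?thesis unfolding rat_adjoin_iff
    by (intro exI[of _ "P * Q' + P' * Q"] exI[of _ "Q * Q'"]) (simp add: add_frac_eq)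
qed

lemma rat_adjoin_mult:
  assumes "x \<in> rat_adjoin \<beta>" "y \<in> rat_adjoin \<beta>"
  shows "x * y \<in> rat_adjoin \<beta>"
proof -
  obtain P Q P' Q' where "int_eval Q \<beta> \<noteq> 0" "x = int_eval P \<beta> / int_eval Q \<beta>"
    "int_eval Q' \<beta> \<noteq> 0" "y = int_eval P' \<beta> / int_eval Q' \<beta>"
    using assms unfolding rat_adjoin_iff by blast
  then show ?thesis unfolding rat_adjoin_iff
    by (intro exI[of _ "P * P'"] exI[of _ "Q * Q'"]) simp
qed

lemma rat_adjoin_inverse:
  assumes "x \<in> rat_adjoin \<beta>"
  shows "inverse x \<in> rat_adjoin \<beta>"
proof (cases "x = 0")
  case True
  \<comment> \<open>Here \<open>inverse 0 = 0\<close>.\<close>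
  then show ?thesis using assms by simp
next
  case False
  obtain P Q where PQ: "int_eval Q \<beta> \<noteq> 0" "x = int_eval P \<beta> / int_eval Q \<beta>"
    using assms unfolding rat_adjoin_iff by blast
  with False show ?thesis unfolding rat_adjoin_iff
    by (intro exI[of _ Q] exI[of _ P]) auto
qed

lemma rat_adjoin_diff:
  assumes "x \<in> rat_adjoin \<beta>" "y \<in> rat_adjoin \<beta>"
  shows "x - y \<in> rat_adjoin \<beta>"
  using rat_adjoin_add[OF assms(1) rat_adjoin_mult[OF rat_adjoin_of_int[of "-1"] assms(2)]] by simp

lemma rat_adjoin_divide:
  assumes "x \<in> rat_adjoin \<beta>" "y \<in> rat_adjoin \<beta>"
  shows "x / y \<in> rat_adjoin \<beta>"
  using rat_adjoin_mult[OF assms(1) rat_adjoin_inverse[OF assms(2)]] by (simp add: divide_inverse)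

lemma rat_adjoin_power: "x \<in> rat_adjoin \<beta> \<Longrightarrow> x ^ n \<in> rat_adjoin \<beta>"
  using rat_adjoin_of_int[of 1] by (induction n) (simp_all add: rat_adjoin_mult)

text \<open>For x = P(\<beta>)/Q(\<beta>), the Bezout identity of \<open>p\<close> and
  \<open>Q\<close> at \<beta> reads v(\<beta>) Q(\<beta>) = k. Hence k x = v(\<beta>) P(\<beta>), so
  \<open>k\<close> is a denominator of x.\<close>

lemma rat_adjoin_common_denominator:
  assumes p: "irreducible p" "degree p > 0" "int_eval p \<beta> = 0"
    and "finite A" "A \<subseteq> rat_adjoin \<beta>"
  shows "\<exists>c>0. \<forall>x\<in>A. \<exists>P. of_int c * x = int_eval P \<beta>"
  using assms(4,5)
proof (induction A rule: finite_induct)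
  case empty
  show ?case by (intro exI[of _ 1]) simp
next
  case (insert x A)
  then obtain c where c: "c > 0" "\<forall>x\<in>A. \<exists>P. of_int c * x = int_eval P \<beta>" by auto
  from insert.prems obtain P Q where Q: "int_eval Q \<beta> \<noteq> 0" and x: "x = int_eval P \<beta> / int_eval Q \<beta>"
    by (auto simp: rat_adjoin_iff)
  have "\<not> p dvd Q" using Q p(3) by (auto elim: dvdE)
  then obtain u v k where k: "k \<noteq> 0" and eq: "u * p + v * Q = [:k:]"
    by (rule irreducible_int_poly_bezout[OF p(1,2)])
  from arg_cong[OF eq, of "\<lambda>h. int_eval h \<beta>"] p(3)
  have vQ: "int_eval v \<beta> * int_eval Q \<beta> = of_int k" by simp
  have kx: "of_int k * x = int_eval (v * P) \<beta>" using Q by (simp add: x flip: vQ)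
  \<comment> \<open>The absolute value keeps the denominator positive; the lost sign returns as the
    factor \<open>sgn k\<close> in the representing polynomial.\<close>
  show ?case
  proof (intro exI[of _ "c * \<bar>k\<bar>"] conjI ballI)
    show "c * \<bar>k\<bar> > 0" using c k by simp
    fix y assume y: "y \<in> insert x A"
    show "\<exists>P. of_int (c * \<bar>k\<bar>) * y = int_eval P \<beta>"
    proof (cases "y = x")
      case True
      have "of_int (c * \<bar>k\<bar>) * y = of_int (c * sgn k) * (of_int k * x)"
        by (simp add: True sgn_if)
      then have "of_int (c * \<bar>k\<bar>) * y = int_eval (smult (c * sgn k) (v * P)) \<beta>"
        unfolding kx by simp
      then show ?thesis by blast
    next
      case False
      with y c obtain R where "of_int c * y = int_eval R \<beta>" by auto
      then have "of_int (c * \<bar>k\<bar>) * y = int_eval (smult \<bar>k\<bar> R) \<beta>" by (simp add: algebra_simps)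
      then show ?thesis by blast
    qed
  qed
qed

section \<open>Orbits of piecewise affine maps\<close>

lemma finite_orbit_imp_eventually_periodic:
  assumes "finite (range (\<lambda>n. (S ^^ n) x))"
  shows "eventually_periodic S x"
proof -
  from assms have "\<not> inj (\<lambda>n. (S ^^ n) x)" using finite_imageD by blast
  then obtain i j where "i \<noteq> j" "(S ^^ i) x = (S ^^ j) x" by (auto simp: inj_def)
  then obtain i j where ij: "i < j" "(S ^^ j) x = (S ^^ i) x" by (metis linorder_neqE_nat)
  have "(S ^^ (n + (j - i))) x = (S ^^ n) x" if "n \<ge> i" for n
  proof -
    \<comment> \<open>Regrouping exposes \<open>S ^^ j\<close> as the first iterate applied to
      \<open>x\<close>, where it can be exchanged for \<open>S ^^ i\<close>.\<close>
    have "n + (j - i) = (n - i) + j" using that ij(1) by simp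
    then have "(S ^^ (n + (j - i))) x = (S ^^ (n - i)) ((S ^^ j) x)"
      by (simp add: funpow_add del: add_diff_assoc2)
    also have "\<dots> = (S ^^ (n - i + i)) x" by (simp only: ij(2) funpow_add o_apply)
    also have "\<dots> = (S ^^ n) x" using that by simp
    finally show ?thesis .
  qed
  moreover have "j - i > 0" using ij(1) by simp
  ultimately show ?thesis unfolding eventually_periodic_def by blast
qed

text \<open>The lower bound on the slope survives any sequence of branches and signs. It makes the
  slope nonzero, and different from 1 once \<open>n > 0\<close>.\<close>

lemma expanding_affine_iterate:
  fixes S :: "real \<Rightarrow> real"
  assumes "\<beta> > 1" "y \<in> X"
    and step: "\<And>y. y \<in> X \<Longrightarrow> S y \<in> X \<and>
      (\<exists>A\<in>rat_adjoin \<beta>. \<exists>B\<in>rat_adjoin \<beta>. \<bar>A\<bar> \<ge> \<beta> \<and> S y = A * y + B)"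
  shows "(S ^^ n) y \<in> X \<and>
    (\<exists>A\<in>rat_adjoin \<beta>. \<exists>B\<in>rat_adjoin \<beta>. \<bar>A\<bar> \<ge> \<beta> ^ n \<and> (S ^^ n) y = A * y + B)"
proof (induction n)
  case 0
  have "1 \<in> rat_adjoin \<beta>" "0 \<in> rat_adjoin \<beta>" "(S ^^ 0) y = 1 * y + 0" "\<beta> ^ 0 \<le> \<bar>1\<bar>"
    using rat_adjoin_of_int[of 1] rat_adjoin_of_int[of 0] by simp_all
  moreover have "(S ^^ 0) y \<in> X" using assms(2) by simp
  ultimately show ?case by blast
next
  case (Suc n)
  then obtain A B where AB: "A \<in> rat_adjoin \<beta>" "B \<in> rat_adjoin \<beta>" "\<bar>A\<bar> \<ge> \<beta> ^ n"
    "(S ^^ n) y = A * y + B" by blast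
  from Suc step obtain A' B' where AB': "A' \<in> rat_adjoin \<beta>" "B' \<in> rat_adjoin \<beta>" "\<bar>A'\<bar> \<ge> \<beta>"
    "S ((S ^^ n) y) = A' * (S ^^ n) y + B'" by blast
  have "\<bar>A' * A\<bar> \<ge> \<beta> ^ Suc n"
    using AB(3) AB'(3) assms(1) by (simp add: abs_mult mult_mono)
  moreover have "(S ^^ Suc n) y = A' * A * y + (A' * B + B')"
    using AB'(4) by (simp add: AB(4) algebra_simps)
  moreover have "A' * A \<in> rat_adjoin \<beta>" "A' * B + B' \<in> rat_adjoin \<beta>"
    using AB AB' by (simp_all add: rat_adjoin_add rat_adjoin_mult)
  moreover have "(S ^^ Suc n) y \<in> X" using Suc step by simp
  ultimately show ?case by blast
qed

text \<open>First the periodic point \<open>y\<close> is found as the fixed point of an affine map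
  with slope other than 1; then the affine map of the preperiod is inverted to recover
  \<open>x\<close>.\<close>

lemma eventually_periodic_imp_rat_adjoin:
  fixes S :: "real \<Rightarrow> real"
  assumes "\<beta> > 1" "x \<in> X"
    and step: "\<And>y. y \<in> X \<Longrightarrow> S y \<in> X \<and>
      (\<exists>A\<in>rat_adjoin \<beta>. \<exists>B\<in>rat_adjoin \<beta>. \<bar>A\<bar> \<ge> \<beta> \<and> S y = A * y + B)"
    and "eventually_periodic S x"
  shows "x \<in> rat_adjoin \<beta>"
proof -
  note iter = expanding_affine_iterate[OF assms(1) _ step]
  from assms(4) obtain N k where k: "k > 0" and per: "(S ^^ (N + k)) x = (S ^^ N) x"
    unfolding eventually_periodic_def by blast
  define y where "y = (S ^^ N) x"
  from iter[OF assms(2), of N] obtain A B where AB: "A \<in> rat_adjoin \<beta>" "B \<in> rat_adjoin \<beta>"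
    "\<bar>A\<bar> \<ge> \<beta> ^ N" "y = A * x + B" and yX: "y \<in> X"
    unfolding y_def by blast
  from iter[OF yX, of k] obtain A' B' where AB': "A' \<in> rat_adjoin \<beta>" "B' \<in> rat_adjoin \<beta>"
    "\<bar>A'\<bar> \<ge> \<beta> ^ k" "(S ^^ k) y = A' * y + B'" by blast
  have "(S ^^ k) y = y"
    using per by (simp add: y_def add.commute[of N] funpow_add)
  moreover have "A' \<noteq> 1" using AB'(3) one_less_power[OF assms(1) k] by auto
  ultimately have "y = B' / (1 - A')" using AB'(4) by (simp add: field_simps)
  moreover have "1 - A' \<in> rat_adjoin \<beta>"
    using rat_adjoin_diff[OF rat_adjoin_of_int[of 1] AB'(1)] by simp
  ultimately have y: "y \<in> rat_adjoin \<beta>" using AB'(2) by (simp add: rat_adjoin_divide)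
  have "\<beta> ^ N > 0" using assms(1) by simp
  with AB(3) have "A \<noteq> 0" by auto
  then have "x = (y - B) / A" using AB(4) by simp
  also have "\<dots> \<in> rat_adjoin \<beta>" using AB(1,2) y by (intro rat_adjoin_divide rat_adjoin_diff)
  finally show ?thesis .
qed

text \<open>Every orbit point is kept together with an integer polynomial representing
  \<open>c\<close> times it, because the values of that polynomial at the other roots must be
  controlled too. The set \<open>G\<close> of points with suitably bounded representatives is
  invariant and finite.\<close>

lemma pisot_finite_orbit:
  fixes S :: "real \<Rightarrow> real" and b :: "'i \<Rightarrow> real"
  assumes "pisot \<beta>" "finite I" "\<And>i. i \<in> I \<Longrightarrow> b i \<in> rat_adjoin \<beta>"
    and x: "x \<in> rat_adjoin \<beta>" "x \<in> {0..1}"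
    and step: "\<And>y. y \<in> {0..1} \<Longrightarrow> S y \<in> {0..1} \<and>
      (\<exists>i\<in>I. \<exists>s m. s \<in> {-1, 1} \<and> m > 0 \<and> S y = s * \<beta> ^ m * y + b i)"
  shows "finite (range (\<lambda>n. (S ^^ n) x))"
proof -
  from assms(1) obtain p where \<beta>: "\<beta> > 1" and monic: "lead_coeff p = 1" and irr: "irreducible p"
    and root: "int_eval p \<beta> = 0"
    and conj: "\<And>z :: complex. int_eval p z = 0 \<Longrightarrow> z \<noteq> of_real \<beta> \<Longrightarrow> cmod z < 1"
    unfolding pisot_def by blast
  \<comment> \<open>A monic constant is 1 and has no root.\<close>
  have deg: "degree p > 0"
    using monic root by (auto intro!: gr0I elim!: degree_eq_zeroE)
  obtain c where c: "c > 0"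
    and cb: "\<And>y. y \<in> insert x (b ` I) \<Longrightarrow> \<exists>P. of_int c * y = int_eval P \<beta>"
    using rat_adjoin_common_denominator[OF irr deg root, of "insert x (b ` I)"] assms(2,3) x(1)
    by blast
  obtain P where P: "of_int c * x = int_eval P \<beta>" using cb by blast
  have "\<forall>i\<in>I. \<exists>B. of_int c * b i = int_eval B \<beta>" using cb by blast
  then obtain B where B: "\<And>i. i \<in> I \<Longrightarrow> of_int c * b i = int_eval (B i) \<beta>" by metis
  define K where "K z = (\<Sum>i\<in>I. cmod (int_eval (B i) z))" for z
  \<comment> \<open>K z / (1 - |z|) is the fixed point of t -> |z| t + K z, so any larger bound is
    preserved by a step; the maximum also covers the starting point. At \<beta>, where there is no
    contraction, the bound \<open>c\<close> comes from the orbit lying in [0,1].\<close>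
  define M where "M z = (if z = of_real \<beta> then of_int c
    else max (cmod (int_eval P z)) (K z / (1 - cmod z)))" for z
  define G where "G = {y \<in> {0..1}. \<exists>R. of_int c * y = int_eval R \<beta> \<and>
    (\<forall>z\<in>int_roots p. cmod (int_eval R z) \<le> M z)}"
  have at_\<beta>: "cmod (int_eval R (of_real \<beta>)) \<le> M (of_real \<beta>)"
    if "of_int c * y = int_eval R \<beta>" "y \<in> {0..1}" for y R
    using that(2) c by (simp add: M_def int_eval_of_real norm_mult mult_left_le flip: that(1))
  have "x \<in> G"
    using x(2) P at_\<beta>[OF P x(2)] unfolding G_def
    by (intro CollectI conjI exI[of _ P] ballI) (auto simp: M_def)
  have G_step: "S y \<in> G" if "y \<in> G" for y
  proof -
    from that obtain R where y: "y \<in> {0..1}" and R: "of_int c * y = int_eval R \<beta>"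
      and bound: "\<And>z. z \<in> int_roots p \<Longrightarrow> cmod (int_eval R z) \<le> M z"
      unfolding G_def by blast
    from step[OF y] obtain i s m where i: "i \<in> I" and s: "s \<in> {-1, 1}" and m: "m > 0"
      and Sy: "S y = s * \<beta> ^ m * y + b i" and Sy01: "S y \<in> {0..1}" by blast
    obtain t :: int where t: "s = of_int t" "\<bar>t\<bar> = 1"
      using s by (metis abs_1 abs_minus insertE of_int_1 of_int_minus singletonD)
    \<comment> \<open>The step of \<open>S\<close> lifted to polynomials; evaluated at a conjugate z
      it becomes a map with linear factor of modulus |z|^m.\<close>
    define R' where "R' = monom t m * R + B i"
    have R': "of_int c * S y = int_eval R' \<beta>"
      by (simp add: R'_def Sy t(1) distrib_left flip: B[OF i] R)
    have "cmod (int_eval R' z) \<le> M z" if z: "z \<in> int_roots p" for z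
    proof (cases "z = of_real \<beta>")
      case True
      then show ?thesis using at_\<beta>[OF R' Sy01] by simp
    next
      case False
      then have z1: "cmod z < 1" using conj z by (auto simp: int_roots_def)
      have "cmod (int_eval R' z) \<le> cmod z ^ m * cmod (int_eval R z) + cmod (int_eval (B i) z)"
      proof -
        have "cmod (of_int t) = 1" using t(2) by (simp flip: of_int_abs)
        then show ?thesis
          unfolding R'_def by (simp, intro order_trans[OF norm_triangle_ineq]) (simp add: norm_mult norm_power)
      qed
      also have "cmod (int_eval (B i) z) \<le> K z"
        unfolding K_def using i assms(2) by (intro member_le_sum) auto
      \<comment> \<open>Since \<open>m > 0\<close> and |z| < 1, every branch contracts at least by
        the factor |z|.\<close>
      also have "cmod z ^ m * cmod (int_eval R z) \<le> cmod z * M z"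
        using m z1 bound[OF z] power_decreasing[of 1 m "cmod z"] by (intro mult_mono) auto
      \<comment> \<open>This is the choice of \<open>M\<close>: the two contributions now add up to
        |z| M z + (1 - |z|) M z = M z.\<close>
      also have "K z \<le> (1 - cmod z) * M z"
      proof -
        have "K z / (1 - cmod z) \<le> M z" using False by (simp add: M_def)
        then show ?thesis using z1 by (simp add: field_simps)
      qed
      finally show ?thesis by (simp add: algebra_simps)
    qed
    then show ?thesis using Sy01 R' unfolding G_def by blast
  qed
  have "(S ^^ n) x \<in> G" for n
    by (induction n) (simp_all add: \<open>x \<in> G\<close> G_step)
  moreover have "finite G"
  proof -
    have \<beta>_root: "of_real \<beta> \<in> int_roots p" by (simp add: int_roots_def int_eval_of_real root)
    \<comment> \<open>Scaling by \<open>c\<close> lands in the finite set of bounded integral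
      elements; as \<open>c > 0\<close> the scaling is injective, so \<open>G\<close> is finite as
      well.\<close>
    have "(\<lambda>y. of_real (of_int c * y) :: complex) ` G \<subseteq>
      {int_eval R (of_real \<beta>) | R. \<forall>z\<in>int_roots p. cmod (int_eval R z) \<le> M z}"
      unfolding G_def by (auto simp: int_eval_of_real simp del: of_real_mult)
    then have "finite ((\<lambda>y. of_real (of_int c * y) :: complex) ` G)"
      using finite_bounded_conjugates[OF irr deg monic \<beta>_root] by (rule finite_subset)
    then show ?thesis by (rule finite_imageD) (use c in \<open>auto intro!: inj_onI\<close>)
  qed
  ultimately show ?thesis by (meson finite_subset image_subsetI)
qed

theorem theorem3p2:
  fixes \<beta> :: real and l :: nat and J :: "nat \<Rightarrow> real set"
    and \<epsilon> :: "nat \<Rightarrow> real" and m :: "nat \<Rightarrow> nat" and b :: "nat \<Rightarrow> real"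
    and S :: "real \<Rightarrow> real"
  assumes "pisot \<beta>"
    and "\<And>i. i \<in> {1..l} \<Longrightarrow> is_interval (J i) \<and> J i \<noteq> {}"
    and "\<And>i j. i \<in> {1..l} \<Longrightarrow> j \<in> {1..l} \<Longrightarrow> i \<noteq> j \<Longrightarrow> J i \<inter> J j = {}"
    and "(\<Union>i\<in>{1..l}. J i) = {0..1}"
    and "\<And>i. i \<in> {1..l} \<Longrightarrow> \<epsilon> i \<in> {-1, 1} \<and> m i > 0 \<and> b i \<in> rat_adjoin \<beta>"
    and "\<And>i x. i \<in> {1..l} \<Longrightarrow> x \<in> J i \<Longrightarrow> S x = \<epsilon> i * \<beta> ^ m i * x + b i"
    and "\<And>x. x \<in> {0..1} \<Longrightarrow> S x \<in> {0..1}"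
    and "x \<in> {0..1}"
  shows "eventually_periodic S x \<longleftrightarrow> x \<in> rat_adjoin \<beta>"
proof -
  have \<beta>: "\<beta> > 1" using assms(1) by (simp add: pisot_def)
  have step: "S y \<in> {0..1} \<and>
      (\<exists>i\<in>{1..l}. \<exists>s k. s \<in> {-1, 1} \<and> k > 0 \<and> S y = s * \<beta> ^ k * y + b i)"
    if y: "y \<in> {0..1}" for y
  proof -
    from y obtain i where i: "i \<in> {1..l}" "y \<in> J i" using assms(4) by blast
    then show ?thesis using assms(5)[OF i(1)] assms(6)[OF i] assms(7)[OF y] by blast
  qed
  \<comment> \<open>For the linear equations a branch matters only through its coefficients in
    Q(\<beta>) and its expansion; a positive exponent gives slope of modulus at least
    \<beta>.\<close>
  have affine_step: "S y \<in> {0..1} \<and>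
      (\<exists>A\<in>rat_adjoin \<beta>. \<exists>B\<in>rat_adjoin \<beta>. \<bar>A\<bar> \<ge> \<beta> \<and> S y = A * y + B)"
    if y: "y \<in> {0..1}" for y
  proof -
    from step[OF y] obtain i s k where i: "i \<in> {1..l}" and s: "s \<in> {-1, 1}" and k: "k > 0"
      and Sy: "S y = s * \<beta> ^ k * y + b i" and Sy01: "S y \<in> {0..1}" by blast
    have "s \<in> rat_adjoin \<beta>"
      using s rat_adjoin_of_int[of 1] rat_adjoin_of_int[of "-1"] by auto
    then have "s * \<beta> ^ k \<in> rat_adjoin \<beta>"
      by (simp add: rat_adjoin_mult rat_adjoin_power rat_adjoin_self)
    moreover have "\<bar>s * \<beta> ^ k\<bar> \<ge> \<beta>"
      using s k \<beta> power_increasing[of 1 k \<beta>] by (auto simp: abs_mult)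
    moreover have "b i \<in> rat_adjoin \<beta>" using assms(5)[OF i] by blast
    ultimately show ?thesis using Sy Sy01 by blast
  qed
  show ?thesis
  proof
    assume "eventually_periodic S x"
    with \<beta> assms(8) affine_step show "x \<in> rat_adjoin \<beta>"
      by (rule eventually_periodic_imp_rat_adjoin)
  next
    assume x: "x \<in> rat_adjoin \<beta>"
    have b: "b i \<in> rat_adjoin \<beta>" if "i \<in> {1..l}" for i using assms(5)[OF that] by blast
    show "eventually_periodic S x"
      by (rule finite_orbit_imp_eventually_periodic,
          rule pisot_finite_orbit[OF assms(1) finite_atLeastAtMost b x assms(8) step])
  qed
qed

end
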